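(* Let $T$ be a semi-infinite banded stochastic matrix admitting a positive bidiagonal factorization, let $N\in\mathbb N_0$, and let $\hat T^{[N]}=\frac{1}{\lambda_0^{[N]}}\delta(u_0^{\langle N\rangle})^{-1}T^{[N]}\delta(u_0^{\langle N\rangle})$ be the stochastic matrix obtained by Perron normalization of the truncation $T^{[N]}$. Then the finite Markov chain on $\{0,1,\dots,N\}$ with transition matrix $\hat T^{[N]}$ is recurrent.
   Context: Semi-infinite matrices are indexed by $\mathbb N_0=\{0,1,2,\dots\}$. Fix integers $p,q\ge1$. $T$ is banded: $T_{n,m}=0$ unless $n-p\le m\le n+q$, with positive entries inside the band. A matrix is stochastic if its entries are nonnegative and every row sums to $1$. A positive bidiagonal factorization of $T$ is a factorization $T=\mathscr L_1\cdots\mathscr L_p\mathscr U_q\cdots\mathscr U_1$ where each $\mathscr L_i$ is lower bidiagonal with positive entries on the main diagonal and first subdiagonal (all other entries zero) and each $\mathscr U_j$ is upper bidiagonal with positive entries on the main diagonal and first superdiagonal (all other entries zero). For a vector $v$, $\delta(v)$ is the diagonal matrix with diagonal entries the entries of $v$. $T^{[N]}=(T_{n,m})_{n,m=0}^N$. Its eigenvalues $\lambda_0^{[N]}>\dots>\lambda_N^{[N]}$ are simple and positive (known), and $u_0^{\langle N\rangle}$ is a right eigenvector of $T^{[N]}$ for $\lambda_0^{[N]}$ with all entries positive (unique up to positive scaling). A state $i$ is recurrent if $\lim_{s\to1^-}F_{i,i}(s)=1$, where $F_{i,i}(s)=\sum_{r\ge1}f^r_{i,i}s^r$ and $f^r_{i,i}=\Pr(X_r=i,X_{r-1}\ne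 i,\dots,X_1\ne i\mid X_0=i)$ (i.e. the probability of ever returning to $i$ is $1$). The chain is recurrent if all states are recurrent. *)

theory Defs
  imports
    "HOL-Probability.Probability_Mass_Function"
    "Jordan_Normal_Form.Char_Poly"
    "Jordan_Normal_Form.Gauss_Jordan_Elimination"
begin

unbundle no vec_syntax
hide_const (open) Finite_Cartesian_Product.vec Finite_Cartesian_Product.row
  Finite_Cartesian_Product.mat Finite_Cartesian_Product.column
hide_type (open) Finite_Cartesian_Product.vec

section \<open>Semi-infinite matrices\<close>

type_synonym smat = "nat \<Rightarrow> nat \<Rightarrow> real"

definition smat_one :: smat where
  "smat_one = (\<lambda>n m. if n = m then 1 else 0)"

text \<open>All matrices multiplied below are banded, hence have finitely supported rows: the series is
  then a finite sum and the product is associative.\<close>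

definition smat_mult :: "smat \<Rightarrow> smat \<Rightarrow> smat" where
  "smat_mult A B = (\<lambda>n m. \<Sum>k. A n k * B k m)"

definition smat_prod :: "smat list \<Rightarrow> smat" where
  "smat_prod As = foldr smat_mult As smat_one"

text \<open>The condition $n - p \le m$ is written additively, to avoid truncated subtraction.\<close>

definition positive_banded :: "nat \<Rightarrow> nat \<Rightarrow> smat \<Rightarrow> bool" where
  "positive_banded p q T \<longleftrightarrow>
     (\<forall>n m. if n \<le> m + p \<and> m \<le> n + q then T n m > 0 else T n m = 0)"

definition stochastic_smat :: "smat \<Rightarrow> bool" where
  "stochastic_smat T \<longleftrightarrow> (\<forall>n m. T n m \<ge> 0) \<and> (\<forall>n. (\<lambda>m. T n m) sums 1)"

definition positive_lower_bidiagonal :: "smat \<Rightarrow> bool" where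
  "positive_lower_bidiagonal L \<longleftrightarrow>
     (\<forall>n m. if n = m \<or> n = Suc m then L n m > 0 else L n m = 0)"

definition positive_upper_bidiagonal :: "smat \<Rightarrow> bool" where
  "positive_upper_bidiagonal U \<longleftrightarrow>
     (\<forall>n m. if m = n \<or> m = Suc n then U n m > 0 else U n m = 0)"

text \<open>The factors occur in the order $L_1, \dots, L_p, U_q, \dots, U_1$.\<close>

definition has_positive_bidiagonal_factorization :: "nat \<Rightarrow> nat \<Rightarrow> smat \<Rightarrow> bool" where
  "has_positive_bidiagonal_factorization p q T \<longleftrightarrow>
     (\<exists>L U. (\<forall>i\<in>{1..p}. positive_lower_bidiagonal (L i)) \<and>
            (\<forall>j\<in>{1..q}. positive_upper_bidiagonal (U j)) \<and>
            T = smat_prod (map L [1..<Suc p] @ map U (rev [1..<Suc q])))"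

section \<open>Truncation and Perron normalization\<close>

text \<open>The truncation to the indices $0, \dots, N$ has size $N + 1$.\<close>

definition truncation :: "smat \<Rightarrow> nat \<Rightarrow> real mat" where
  "truncation T N = Matrix.mat (Suc N) (Suc N) (\<lambda>(n, m). T n m)"

text \<open>For the truncations considered here all complex eigenvalues are real, so this is the
  largest eigenvalue $\lambda_0$.\<close>

definition largest_eigenvalue :: "real mat \<Rightarrow> real" where
  "largest_eigenvalue A = Max {l. eigenvalue A l}"

definition vec_diag :: "real vec \<Rightarrow> real mat" where
  "vec_diag v = mat_diag (dim_vec v) (\<lambda>i. v $ i)"

definition perron_normalization :: "smat \<Rightarrow> nat \<Rightarrow> real vec \<Rightarrow> real mat" where
  "perron_normalization T N u =
     (1 / largest_eigenvalue (truncation T N)) \<cdot>\<^sub>m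
       (the (mat_inverse (vec_diag u)) * truncation T N * vec_diag u)"

definition stochastic_mat :: "real mat \<Rightarrow> bool" where
  "stochastic_mat P \<longleftrightarrow> dim_row P = dim_col P \<and>
     (\<forall>i<dim_row P. (\<forall>j<dim_col P. P $$ (i, j) \<ge> 0) \<and> (\<Sum>j<dim_col P. P $$ (i, j)) = 1)"

section \<open>Finite Markov chains\<close>

text \<open>A stochastic matrix of size $n$ is the transition matrix of a chain on $\{0, \dots, n-1\}$.
  \<open>transition_pmf P i\<close> is the distribution of the next state from \<open>i\<close>, and
  \<open>trajectory P i r\<close> is the joint law of $(X_0, \dots, X_r)$ conditioned on $X_0 = i$; in a
  list \<open>xs\<close> drawn from it, \<open>xs ! k\<close> is the value of $X_k$.  These are meaningful only for
  stochastic \<open>P\<close> and \<open>i < dim_row P\<close>: see lemma \<open>pmf_transition_pmf\<close>, and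
  lemma \<open>stochastic_perron_normalization\<close> for the matrices of interest.\<close>

definition transition_pmf :: "real mat \<Rightarrow> nat \<Rightarrow> nat pmf" where
  "transition_pmf P i = embed_pmf (\<lambda>j. if j < dim_col P then P $$ (i, j) else 0)"

primrec trajectory :: "real mat \<Rightarrow> nat \<Rightarrow> nat \<Rightarrow> nat list pmf" where
  "trajectory P i 0 = return_pmf [i]"
| "trajectory P i (Suc r) =
     bind_pmf (trajectory P i r) (\<lambda>xs. map_pmf (\<lambda>j. xs @ [j]) (transition_pmf P (last xs)))"

definition first_return_prob :: "real mat \<Rightarrow> nat \<Rightarrow> nat \<Rightarrow> real" where
  "first_return_prob P i r =
     measure_pmf.prob (trajectory P i r) {xs. xs ! r = i \<and> (\<forall>k\<in>{1..<r}. xs ! k \<noteq> i)}"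

definition first_return_gf :: "real mat \<Rightarrow> nat \<Rightarrow> real \<Rightarrow> real" where
  "first_return_gf P i s = (\<Sum>r. first_return_prob P i (Suc r) * s ^ Suc r)"

definition recurrent_state :: "real mat \<Rightarrow> nat \<Rightarrow> bool" where
  "recurrent_state P i \<longleftrightarrow> (first_return_gf P i \<longlongrightarrow> 1) (at_left 1)"

definition recurrent_chain :: "real mat \<Rightarrow> bool" where
  "recurrent_chain P \<longleftrightarrow> (\<forall>i<dim_row P. recurrent_state P i)"

section \<open>Well-definedness\<close>

lemma pmf_transition_pmf:
  assumes "stochastic_mat P" "i < dim_row P"
  shows "pmf (transition_pmf P i) j = (if j < dim_col P then P $$ (i, j) else 0)"
proof -
  let ?f = "\<lambda>j. if j < dim_col P then P $$ (i, j) else 0"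
  have nn: "\<And>j. ?f j \<ge> 0" using assms by (auto simp: stochastic_mat_def)
  have nn': "\<And>j. j < dim_col P \<Longrightarrow> P $$ (i, j) \<ge> 0" using assms by (auto simp: stochastic_mat_def)
  have "(\<integral>\<^sup>+ j. ennreal (?f j) \<partial>count_space UNIV) = (\<Sum>j<dim_col P. ennreal (?f j))"
    by (subst nn_integral_count_space'[of "{..<dim_col P}"]) (use nn' in auto)
  also have "\<dots> = ennreal (\<Sum>j<dim_col P. ?f j)"
    using nn' by (intro sum_ennreal) auto
  also have "(\<Sum>j<dim_col P. ?f j) = 1"
    using assms by (auto simp: stochastic_mat_def)
  finally show ?thesis unfolding transition_pmf_def
    by (subst pmf_embed_pmf) (use nn' in auto)
qed

lemma perron_normalization_eq:
  assumes "dim_vec u = Suc N" and "\<And>i. i \<le> N \<Longrightarrow> u $ i > 0"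
  shows "perron_normalization T N u = Matrix.mat (Suc N) (Suc N)
           (\<lambda>(i, j). T i j * u $ j / (largest_eigenvalue (truncation T N) * u $ i))"
proof -
  let ?n = "Suc N"
  let ?D = "vec_diag u" and ?E = "mat_diag ?n (\<lambda>i. 1 / u $ i)"
  have D: "?D \<in> carrier_mat ?n ?n" and E: "?E \<in> carrier_mat ?n ?n"
    using assms(1) by (simp_all add: vec_diag_def)
  have nz: "u $ i \<noteq> 0" if "i < ?n" for i using assms(2)[of i] that by simp
  have ED: "?E * ?D = 1\<^sub>m ?n" "?D * ?E = 1\<^sub>m ?n"
    using nz assms(1) unfolding vec_diag_def assms(1) mat_diag_diag
    by (auto simp: mat_diag_def intro!: eq_matI)
  have "?D \<in> Units (ring_mat TYPE(real) ?n ())"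
    using D E ED by (auto simp: Units_def ring_mat_def)
  then obtain B where B: "mat_inverse ?D = Some B"
    using mat_inverse(1)[OF D, where b = "()"] by (cases "mat_inverse ?D") auto
  have "B * ?D = 1\<^sub>m ?n" and Bc: "B \<in> carrier_mat ?n ?n" using mat_inverse(2)[OF D B] by auto
  then have "B = ?E"
    using ED(2) assoc_mult_mat[OF Bc D E] left_mult_one_mat[OF E] right_mult_one_mat[OF Bc] by simp
  then have inv: "the (mat_inverse ?D) = ?E" using B by simp
  have Tc: "truncation T N \<in> carrier_mat ?n ?n" by (simp add: truncation_def)
  show ?thesis
    unfolding perron_normalization_def inv
    unfolding mat_diag_mult_left[OF Tc] vec_diag_def assms(1)
    by (subst mat_diag_mult_right[of _ ?n ?n]) (auto simp: truncation_def intro!: eq_matI)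
qed

lemma stochastic_perron_normalization:
  assumes T: "positive_banded p q T"
    and ev: "eigenvector (truncation T N) u (largest_eigenvalue (truncation T N))"
    and pos: "\<And>i. i \<le> N \<Longrightarrow> u $ i > 0"
  shows "stochastic_mat (perron_normalization T N u)"
proof -
  let ?l = "largest_eigenvalue (truncation T N)"
  have dim: "dim_vec u = Suc N" and eq: "truncation T N *\<^sub>v u = ?l \<cdot>\<^sub>v u"
    using ev by (auto simp: eigenvector_def truncation_def)
  have row: "(\<Sum>j<Suc N. T i j * u $ j) = ?l * u $ i" if "i < Suc N" for i
  proof -
    have "(truncation T N *\<^sub>v u) $ i = (\<Sum>j<Suc N. T i j * u $ j)"
      using that dim unfolding lessThan_atLeast0
      by (auto simp: truncation_def scalar_prod_def intro!: sum.cong)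
    then show ?thesis using eq that dim by simp
  qed
  have nn: "T i j \<ge> 0" for i j
    using T unfolding positive_banded_def by (metis less_imp_le order_refl)
  have "0 < T 0 0 * u $ 0"
    using T pos[of 0] unfolding positive_banded_def by (metis le0 mult_pos_pos)
  also have "\<dots> \<le> (\<Sum>j<Suc N. T 0 j * u $ j)"
    using nn pos by (intro member_le_sum[where f = "\<lambda>j. T 0 j * u $ j"])
      (auto simp: less_Suc_eq_le intro!: mult_nonneg_nonneg order.strict_implies_order[of 0 "u $ _"])
  also have "\<dots> = ?l * u $ 0" by (rule row) simp
  finally have l: "?l > 0" using pos[of 0] by (simp add: zero_less_mult_iff)
  have P: "perron_normalization T N u = Matrix.mat (Suc N) (Suc N)
      (\<lambda>(i, j). T i j * u $ j / (?l * u $ i))"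
    by (rule perron_normalization_eq) (use dim pos in auto)
  have "(\<Sum>j<Suc N. T i j * u $ j / (?l * u $ i)) = 1" if "i < Suc N" for i
    unfolding sum_divide_distrib[symmetric] row[OF that] using l pos[of i] that by simp
  then show ?thesis
    unfolding P stochastic_mat_def
    using nn l pos by (auto simp: less_Suc_eq_le simp del: sum.lessThan_Suc
        intro!: divide_nonneg_nonneg mult_nonneg_nonneg order.strict_implies_order[of 0 "u $ _"])
qed

end

theory Submission
  imports Defs
begin

text \<open>The normalized truncation is an irreducible stochastic matrix, because its first sub- and
  superdiagonals are positive; and a finite irreducible chain is recurrent. For the latter, let
  $a_r(j)$ be the probability that the chain started in $i$ is in $j$ at time $r$ without having
  returned to $i$. The first return probabilities satisfy $\sum_{s \le r} f_s = 1 - \sum_j a_r(j)$,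
  so they are summable. If $j \to i$ is a possible transition, then $a_r(j)$ is at most a constant
  times $f_{r+1}$, and if $j \to k$ is one with $k \ne i$, it is at most a constant times
  $a_{r+1}(k)$. By irreducibility $a_r(j)$ is summable in $r$ for all $j$, hence
  $\sum_j a_r(j) \to 0$ and $\sum_s f_s = 1$.\<close>

section \<open>Taboo probabilities and first returns\<close>

text \<open>The quantity $a_r(j)$ above. The range \<open>{1..r}\<close> omits time 0, so the start
  in \<open>i\<close> does not count as a return and all mass sits at \<open>i\<close> when
  \<open>r = 0\<close>.\<close>

definition taboo_prob :: "real mat \<Rightarrow> nat \<Rightarrow> nat \<Rightarrow> nat \<Rightarrow> real" where
  "taboo_prob P i r j =
     measure_pmf.prob (trajectory P i r) {xs. xs ! r = j \<and> (\<forall>k\<in>{1..r}. xs ! k \<noteq> i)}"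

definition positive_transitions :: "real mat \<Rightarrow> (nat \<times> nat) set" where
  "positive_transitions P = {(j, k). j < dim_row P \<and> k < dim_row P \<and> P $$ (j, k) > 0}"

text \<open>Guarantees that \<open>last xs\<close> is the state at time \<open>r\<close> and lies in
  the range where \<open>pmf_transition_pmf\<close> applies.\<close>

lemma set_pmf_trajectory:
  assumes P: "stochastic_mat P" and i: "i < dim_row P" and xs: "xs \<in> set_pmf (trajectory P i r)"
  shows "length xs = Suc r" and "xs ! r < dim_row P"
proof -
  have "length xs = Suc r \<and> xs ! r < dim_row P"
    using xs
  proof (induction r arbitrary: xs)
    case 0
    then show ?case using i by simp
  next
    case (Suc r)
    then obtain ys j where ys: "ys \<in> set_pmf (trajectory P i r)"
      and j: "j \<in> set_pmf (transition_pmf P (last ys))" and xs: "xs = ys @ [j]"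
      by auto
    have len: "length ys = Suc r" and lt: "ys ! r < dim_row P"
      using Suc.IH[OF ys] by auto
    then have "last ys = ys ! r"
      by (metis diff_Suc_1 last_conv_nth list.size(3) nat.distinct(1))
    with j lt P have "j < dim_row P"
      by (auto simp: set_pmf_iff pmf_transition_pmf stochastic_mat_def split: if_splits)
    then show ?case using xs len by (simp add: nth_append)
  qed
  then show "length xs = Suc r" "xs ! r < dim_row P" by auto
qed

text \<open>Condition on the state at time \<open>r\<close>. The event avoids \<open>i\<close> only
  up to time \<open>r\<close>, so one formula serves both recursions: \<open>j = i\<close> gives the
  first return at time \<open>Suc r\<close>, and \<open>j \<noteq> i\<close> gives the next taboo
  probability.\<close>

lemma prob_trajectory_Suc:
  assumes P: "stochastic_mat P" and i: "i < dim_row P" and j: "j < dim_row P"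
  shows "measure_pmf.prob (trajectory P i (Suc r))
           {xs. xs ! Suc r = j \<and> (\<forall>k\<in>{1..r}. xs ! k \<noteq> i)} =
         (\<Sum>k<dim_row P. taboo_prob P i r k * P $$ (k, j))"
    (is "measure_pmf.prob _ ?X = _")
proof -
  let ?E = "\<lambda>l. {xs. xs ! r = l \<and> (\<forall>k\<in>{1..r}. xs ! k \<noteq> i)}"
  have nn: "P $$ (l, j) \<ge> 0" if "l < dim_row P" for l
    using P j that by (auto simp: stochastic_mat_def)
  have dim: "dim_col P = dim_row P" using P by (simp add: stochastic_mat_def)
  \<comment> \<open>For a fixed past only the summand \<open>l = xs ! r\<close> can be nonzero.
    Writing it as a sum of indicators lets the integral over the past be taken state by
    state.\<close>
  have step: "emeasure (measure_pmf (map_pmf (\<lambda>l. xs @ [l]) (transition_pmf P (last xs)))) ?X =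
      (\<Sum>l<dim_row P. ennreal (P $$ (l, j)) * indicator (?E l) xs)"
    if xs: "xs \<in> set_pmf (trajectory P i r)" for xs
  proof -
    note len = set_pmf_trajectory(1)[OF P i xs] and lt = set_pmf_trajectory(2)[OF P i xs]
    have last: "last xs = xs ! r"
      using len by (metis diff_Suc_1 last_conv_nth list.size(3) nat.distinct(1))
    have "(\<lambda>l. xs @ [l]) -` ?X = (if \<forall>k\<in>{1..r}. xs ! k \<noteq> i then {j} else {})"
      using len by (auto simp: nth_append)
    then have "emeasure (measure_pmf (map_pmf (\<lambda>l. xs @ [l]) (transition_pmf P (last xs)))) ?X =
        (if \<forall>k\<in>{1..r}. xs ! k \<noteq> i then ennreal (P $$ (xs ! r, j)) else 0)"
      using P lt j by (simp add: last emeasure_pmf_single pmf_transition_pmf dim)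
    also have "\<dots> = (\<Sum>l<dim_row P. if l = xs ! r
        then ennreal (P $$ (l, j)) * indicator (?E l) xs else 0)"
      using lt by (subst sum.delta) auto
    also have "\<dots> = (\<Sum>l<dim_row P. ennreal (P $$ (l, j)) * indicator (?E l) xs)"
      by (intro sum.cong) auto
    finally show ?thesis .
  qed
  have "emeasure (measure_pmf (trajectory P i (Suc r))) ?X =
      (\<integral>\<^sup>+ xs. emeasure (measure_pmf (map_pmf (\<lambda>l. xs @ [l]) (transition_pmf P (last xs)))) ?X
        \<partial>measure_pmf (trajectory P i r))"
    by simp
  also have "\<dots> = (\<integral>\<^sup>+ xs. (\<Sum>l<dim_row P. ennreal (P $$ (l, j)) * indicator (?E l) xs)
        \<partial>measure_pmf (trajectory P i r))"
    by (intro nn_integral_cong_AE AE_pmfI step)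
  also have "\<dots> = (\<Sum>l<dim_row P. ennreal (P $$ (l, j)) * ennreal (taboo_prob P i r l))"
    by (subst nn_integral_sum)
      (auto simp: nn_integral_cmult taboo_prob_def measure_pmf.emeasure_eq_measure)
  also have "\<dots> = (\<Sum>l<dim_row P. ennreal (taboo_prob P i r l * P $$ (l, j)))"
    using nn by (intro sum.cong refl) (auto simp: taboo_prob_def ennreal_mult mult.commute)
  also have "\<dots> = ennreal (\<Sum>l<dim_row P. taboo_prob P i r l * P $$ (l, j))"
    using nn by (intro sum_ennreal) (auto simp: taboo_prob_def)
  finally show ?thesis
    unfolding measure_pmf.emeasure_eq_measure
    by (subst (asm) ennreal_inj) (auto simp: taboo_prob_def intro!: sum_nonneg mult_nonneg_nonneg nn)
qed

lemma taboo_prob_nonneg: "taboo_prob P i r j \<ge> 0"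
  by (simp add: taboo_prob_def)

lemma taboo_prob_0: "taboo_prob P i 0 j = (if j = i then 1 else 0)"
  by (auto simp: taboo_prob_def measure_pmf_single indicator_def)

lemma first_return_prob_nonneg: "first_return_prob P i r \<ge> 0"
  by (simp add: first_return_prob_def)

lemma first_return_prob_Suc:
  assumes "stochastic_mat P" and "i < dim_row P"
  shows "first_return_prob P i (Suc r) = (\<Sum>k<dim_row P. taboo_prob P i r k * P $$ (k, i))"
  using prob_trajectory_Suc[OF assms assms(2), of r]
  by (simp add: first_return_prob_def atLeastLessThanSuc_atLeastAtMost del: trajectory.simps)

lemma taboo_prob_Suc:
  assumes "stochastic_mat P" and "i < dim_row P" and "j < dim_row P"
  shows "taboo_prob P i (Suc r) j =
           (if j = i then 0 else \<Sum>k<dim_row P. taboo_prob P i r k * P $$ (k, j))"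
proof (cases "j = i")
  case True
  then have "{xs. xs ! Suc r = j \<and> (\<forall>k\<in>{1..Suc r}. xs ! k \<noteq> i)} = {}"
    using True by (intro equals0I) (auto dest!: bspec[where x = "Suc r"])
  then have "taboo_prob P i (Suc r) j = 0" unfolding taboo_prob_def by (simp only: measure_empty)
  then show ?thesis using True by simp
next
  case False
  then have "{xs. xs ! Suc r = j \<and> (\<forall>k\<in>{1..Suc r}. xs ! k \<noteq> i)} =
      {xs. xs ! Suc r = j \<and> (\<forall>k\<in>{1..r}. xs ! k \<noteq> i)}"
    by (auto simp: atLeastAtMostSuc_conv)
  then show ?thesis
    using False prob_trajectory_Suc[OF assms, of r]
    by (simp add: taboo_prob_def[of _ _ "Suc r"] del: trajectory.simps)
qed

text \<open>Conservation of mass: since rows sum to 1, the mass lost by the taboo distribution in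
  one step is exactly the mass entering \<open>i\<close>.\<close>

lemma sum_first_return_prob:
  assumes P: "stochastic_mat P" and i: "i < dim_row P"
  shows "(\<Sum>s<r. first_return_prob P i (Suc s)) = 1 - (\<Sum>j<dim_row P. taboo_prob P i r j)"
proof (induction r)
  case 0
  then show ?case using i by (simp add: taboo_prob_0)
next
  case (Suc r)
  let ?n = "dim_row P" and ?b = "\<lambda>j. \<Sum>k<dim_row P. taboo_prob P i r k * P $$ (k, j)"
  \<comment> \<open>The taboo recursion covers the columns other than \<open>i\<close>, the first
    return probability covers column \<open>i\<close>.\<close>
  have "(\<Sum>j<?n. taboo_prob P i (Suc r) j) + first_return_prob P i (Suc r) =
      (\<Sum>j<?n. if j = i then 0 else ?b j) + (\<Sum>j<?n. if j = i then ?b j else 0)"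
    using i by (simp add: taboo_prob_Suc[OF P i] first_return_prob_Suc[OF P i])
  also have "\<dots> = (\<Sum>j<?n. ?b j)"
    unfolding sum.distrib[symmetric] by (intro sum.cong) auto
  also have "\<dots> = (\<Sum>k<?n. taboo_prob P i r k * (\<Sum>j<?n. P $$ (k, j)))"
    by (subst sum.swap) (simp add: sum_distrib_left)
  also have "\<dots> = (\<Sum>k<?n. taboo_prob P i r k)"
    using P by (intro sum.cong) (auto simp: stochastic_mat_def)
  finally show ?case using Suc.IH by simp
qed

section \<open>Summability and recurrence\<close>

lemma summable_first_return_prob:
  assumes "stochastic_mat P" and "i < dim_row P"
  shows "summable (\<lambda>r. first_return_prob P i (Suc r))"
  by (rule summableI_nonneg_bounded[where x = 1])
    (auto simp: first_return_prob_nonneg sum_first_return_prob[OF assms] sum_nonneg taboo_prob_nonneg)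

text \<open>Induction backwards from \<open>i\<close> along the path: summability passes from the
  target of an edge to its source, at the cost of the factor \<open>1 / P $$ (j, k)\<close>.\<close>

lemma summable_taboo_prob:
  assumes P: "stochastic_mat P" and i: "i < dim_row P"
    and path: "(j, i) \<in> (positive_transitions P)\<^sup>*"
  shows "summable (\<lambda>r. taboo_prob P i r j)"
  using path
proof (induction rule: converse_rtrancl_induct)
  case base
  then show ?case
    \<comment> \<open>Only the term at time 0 is nonzero, and the shift drops it.\<close>
    by (subst summable_Suc_iff[symmetric]) (simp add: taboo_prob_Suc[OF P i i])
next
  case (step j k)
  then have j: "j < dim_row P" and k: "k < dim_row P" and pos: "P $$ (j, k) > 0"
    by (auto simp: positive_transitions_def)
  \<comment> \<open>The mass flowing into \<open>k\<close> at time \<open>Suc r\<close>: a first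
    return if \<open>k = i\<close>, and the next taboo probability of \<open>k\<close>
    otherwise.\<close>
  let ?b = "\<lambda>r. \<Sum>l<dim_row P. taboo_prob P i r l * P $$ (l, k)"
  have "summable ?b"
  proof (cases "k = i")
    case True
    then show ?thesis
      using summable_first_return_prob[OF P i] by (simp add: first_return_prob_Suc[OF P i])
  next
    case False
    then show ?thesis
      using step.IH by (subst (asm) summable_Suc_iff[symmetric]) (simp add: taboo_prob_Suc[OF P i k])
  qed
  then have "summable (\<lambda>r. ?b r / P $$ (j, k))" by (rule summable_divide)
  then show ?case
  proof (rule summable_comparison_test_ev[rotated], intro always_eventually allI)
    fix r
    have "taboo_prob P i r j * P $$ (j, k) \<le> ?b r"
      using P j k by (intro member_le_sum[where f = "\<lambda>l. taboo_prob P i r l * P $$ (l, k)"])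
        (auto simp: stochastic_mat_def taboo_prob_nonneg)
    then show "norm (taboo_prob P i r j) \<le> ?b r / P $$ (j, k)"
      using pos by (simp add: taboo_prob_nonneg field_simps)
  qed
qed

lemma first_return_prob_sums_1:
  assumes P: "stochastic_mat P" and i: "i < dim_row P"
    and path: "\<And>j. j < dim_row P \<Longrightarrow> (j, i) \<in> (positive_transitions P)\<^sup>*"
  shows "(\<lambda>r. first_return_prob P i (Suc r)) sums 1"
proof -
  \<comment> \<open>Each taboo probability is the term of a convergent series, and there are
    finitely many states, so the surviving mass vanishes.\<close>
  have "(\<lambda>r. 1 - (\<Sum>j<dim_row P. taboo_prob P i r j)) \<longlonglongrightarrow> 1 - (\<Sum>j<dim_row P. 0)"
    by (intro tendsto_intros summable_LIMSEQ_zero summable_taboo_prob[OF P i] path) auto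
  then show ?thesis
    by (simp add: sums_def sum_first_return_prob[OF P i])
qed

text \<open>Since the coefficients are nonnegative, \<open>f\<close> itself dominates the terms for
  \<open>s\<close> in (0, 1), and dominated convergence for series gives the limit.\<close>

lemma Abel_limit_nonneg:
  fixes f :: "nat \<Rightarrow> real"
  assumes f: "f sums l" and nonneg: "\<And>r. f r \<ge> 0"
  shows "((\<lambda>s. \<Sum>r. f r * s ^ Suc r) \<longlongrightarrow> l) (at_left 1)"
proof -
  have ev: "\<forall>\<^sub>F s in at_left (1::real). s \<in> {0<..<1}"
    by (rule eventually_at_leftI[of 0]) auto
  have "((\<lambda>s. \<Sum>r. f r * s ^ Suc r) \<longlongrightarrow> (\<Sum>r. f r * 1 ^ Suc r)) (at_left 1)"
  proof (rule tannerys_theorem[THEN conjunct2, THEN conjunct2])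
    show "summable f" using f by (rule sums_summable)
  next
    show "\<forall>\<^sub>F (r, s) in sequentially \<times>\<^sub>F at_left 1. norm (f r * s ^ Suc r) \<le> f r"
      using eventually_prodI[OF eventually_True ev]
    proof (rule eventually_mono)
      fix x :: "nat \<times> real"
      assume "True \<and> snd x \<in> {0<..<1}"
      then have "\<bar>snd x ^ Suc (fst x)\<bar> \<le> 1"
        unfolding power_abs by (intro power_le_one) auto
      then have "\<bar>f (fst x)\<bar> * \<bar>snd x ^ Suc (fst x)\<bar> \<le> \<bar>f (fst x)\<bar> * 1"
        by (intro mult_left_mono) auto
      then show "case x of (r, s) \<Rightarrow> norm (f r * s ^ Suc r) \<le> f r"
        using nonneg by (simp add: case_prod_beta abs_mult del: power_Suc)
    qed
  qed (auto intro!: tendsto_eq_intros)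
  then show ?thesis using f by (simp add: sums_iff)
qed

lemma recurrent_chain_irreducible:
  assumes P: "stochastic_mat P"
    and irred: "\<And>i j. i < dim_row P \<Longrightarrow> j < dim_row P \<Longrightarrow> (j, i) \<in> (positive_transitions P)\<^sup>*"
  shows "recurrent_chain P"
  unfolding recurrent_chain_def recurrent_state_def
proof (intro allI impI)
  fix i assume i: "i < dim_row P"
  show "(first_return_gf P i \<longlongrightarrow> 1) (at_left 1)"
    unfolding first_return_gf_def[abs_def]
    by (rule Abel_limit_nonneg[OF first_return_prob_sums_1[OF P i irred[OF i]]])
      (auto simp: first_return_prob_nonneg)
qed

section \<open>Irreducibility of the normalized truncation\<close>

text \<open>Walk down from \<open>j\<close> to 0 by unit steps, then up to \<open>i\<close>.\<close>

lemma irreducible_tridiagonal: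
  assumes up: "\<And>j. Suc j < dim_row P \<Longrightarrow> P $$ (j, Suc j) > 0"
    and down: "\<And>j. Suc j < dim_row P \<Longrightarrow> P $$ (Suc j, j) > 0"
    and i: "i < dim_row P" and j: "j < dim_row P"
  shows "(j, i) \<in> (positive_transitions P)\<^sup>*"
proof -
  have "(j, 0) \<in> (positive_transitions P)\<^sup>*"
    using j
  proof (induction j)
    case (Suc j)
    then have "(Suc j, j) \<in> positive_transitions P" and "(j, 0) \<in> (positive_transitions P)\<^sup>*"
      using down[of j] by (auto simp: positive_transitions_def)
    then show ?case by (rule converse_rtrancl_into_rtrancl)
  qed simp
  moreover have "(0, i) \<in> (positive_transitions P)\<^sup>*"
    using i
  proof (induction i)
    case (Suc i)
    then have "(0, i) \<in> (positive_transitions P)\<^sup>*" and "(i, Suc i) \<in> positive_transitions P"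
      using up[of i] by (auto simp: positive_transitions_def)
    then show ?case by (rule rtrancl_into_rtrancl)
  qed simp
  ultimately show ?thesis by (rule rtrancl_trans)
qed

theorem theorem2p11:
  fixes T :: "nat \<Rightarrow> nat \<Rightarrow> real" and p q N :: nat and u :: "real vec"
  assumes "p \<ge> 1" and "q \<ge> 1"
    and "positive_banded p q T"
    and "stochastic_smat T"
    and "has_positive_bidiagonal_factorization p q T"
    and "eigenvector (truncation T N) u (largest_eigenvalue (truncation T N))"
    and "\<forall>i\<le>N. u $ i > 0"
  shows "recurrent_chain (perron_normalization T N u)"
proof -
  let ?P = "perron_normalization T N u" and ?l = "largest_eigenvalue (truncation T N)"
  have dim: "dim_vec u = Suc N"
    using assms(6) by (auto simp: eigenvector_def truncation_def)
  have P: "?P = Matrix.mat (Suc N) (Suc N) (\<lambda>(i, j). T i j * u $ j / (?l * u $ i))"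
    by (rule perron_normalization_eq) (use dim assms(7) in auto)
  have stoch: "stochastic_mat ?P"
    using stochastic_perron_normalization assms(3,6,7) by blast
  have dims: "dim_row ?P = Suc N" "dim_col ?P = Suc N" by (simp_all add: P)
  have rowsum: "(\<Sum>j<Suc N. T 0 j * u $ j / (?l * u $ 0)) = 1"
    using stoch unfolding P stochastic_mat_def by (auto simp del: sum.lessThan_Suc)
  \<comment> \<open>As \<open>p\<close> and \<open>q\<close> are at least 1, the band contains the
    three central diagonals.\<close>
  have T: "T n m > 0" if "n \<le> Suc m" "m \<le> Suc n" for n m
  proof -
    have "n \<le> m + p \<and> m \<le> n + q" using that assms(1,2) by linarith
    then show ?thesis using assms(3) unfolding positive_banded_def by presburger
  qed
  \<comment> \<open>The factor \<open>u $ 0\<close> cancels in the entry at (0, 0), which therefore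
    has the sign of \<open>?l\<close>. The value 0 is excluded because division by zero yields 0, so
    row 0 could not sum to 1.\<close>
  have l: "?l > 0"
  proof -
    have "?P $$ (0, 0) \<ge> 0"
      using stoch dims unfolding stochastic_mat_def by (metis zero_less_Suc)
    moreover have "?l \<noteq> 0" using rowsum by auto
    moreover have "T 0 0 > 0" "u $ 0 > 0" using T[of 0 0] assms(7) by auto
    ultimately show ?thesis
      by (simp add: P zero_le_divide_iff)
  qed
  have "?P $$ (j, k) > 0" if "j < Suc N" "k < Suc N" "j \<le> Suc k" "k \<le> Suc j" for j k
    using that T[of j k] l assms(7) by (auto simp: P)
  then show ?thesis using dims
    by (intro recurrent_chain_irreducible[OF stoch] irreducible_tridiagonal) auto
qed

end
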